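(* Let $n\ge2$ and let $\psi_0:\Lambda^+_{\mathrm{wt}}\to\coprod_{k=0}^{n-1}W_{\hat k}\backslash W/W_{\hat 0}$ be the bijection described in the context. Then a dominant weight $\lambda=\sum_{i=1}^{n-1}g_i\varpi_i$ is sent to the double coset $p=\psi_0(\lambda)\in W_{\widehat{\mathrm{sh}(\lambda)}}\backslash W/W_{\hat0}$ for which the element $w=\bar p\,w_{\hat0}$ satisfies, for $1\le i\le n$, $$w(i)=i+\sum_{1\le j<i}g_jn+\sum_{1\le j<n}g_j(j-n).$$
   Context: $\Omega=\mathbb{Z}/n\mathbb{Z}$. $W$ is the affine Weyl group realised as the group of permutations $w$ of $\mathbb{Z}$ with $w(i+n)=w(i)+n$ and $\sum_{i=1}^nw(i)=\sum_{i=1}^ni$; simple reflections $S=\{s_i\}_{i\in\Omega}$, where $s_i$ swaps $j,j+1$ for all $j\equiv i$ mod $n$. $\hat k=S\setminus\{s_k\}$, $W_{\hat k}$ the (finite) parabolic subgroup, $w_{\hat k}$ its longest element. For a double coset $p$, $\bar p$ denotes its unique maximal element in the Bruhat order. $\Lambda^+_{\mathrm{wt}}$ is the $\mathbb{Z}_{\ge0}$-span of the fundamental weights $\varpi_1,\dots,\varpi_{n-1}$ of $\mathfrak{sl}_n$, and $\mathrm{sh}(\sum g_j\varpi_j)=\sum jg_j\in\Omega$. The bijection $\psi_0$: for $k\in\mathbb{Z}$ and $p\in W_{\hat k}\backslash W/W_{\hat0}$, the element $w=\bar p\,w_{\hat0}$ is the unique element of $p$ with $w(1)<\cdots<w(n)$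 and $w(i)\equiv k+i$ mod $n$; setting $w(i)=k+i+c_in$ gives integers $c_1\le\cdots\le c_n$ with $\sum c_i=-k$, well defined up to adding a common integer to all $c_i$ (corresponding to changing $k$ modulo $n$). The map $p\mapsto\sum_{i=1}^{n-1}(c_{i+1}-c_i)\varpi_i$ is a bijection $\coprod_{k=0}^{n-1}W_{\hat k}\backslash W/W_{\hat0}\to\Lambda^+_{\mathrm{wt}}$, and $\psi_0$ is its inverse. *)

theory Defs
  imports Complex_Main "HOL-Library.FuncSet" "HOL-Algebra.Generated_Groups" "HOL-Number_Theory.Cong"
begin

section \<open>Length, Bruhat order and double cosets for a group with a generating set\<close>

definition word_length :: "('a, 'b) monoid_scheme \<Rightarrow> 'a set \<Rightarrow> 'a \<Rightarrow> nat" where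
  "word_length G S w =
     (LEAST m. \<exists>ss. length ss = m \<and> set ss \<subseteq> S \<and> foldr (\<lambda>x y. x \<otimes>\<^bsub>G\<^esub> y) ss \<one>\<^bsub>G\<^esub> = w)"

definition reflections :: "('a, 'b) monoid_scheme \<Rightarrow> 'a set \<Rightarrow> 'a set" where
  "reflections G S = {x \<otimes>\<^bsub>G\<^esub> s \<otimes>\<^bsub>G\<^esub> inv\<^bsub>G\<^esub> x | x s. x \<in> carrier G \<and> s \<in> S}"

definition bruhat_step :: "('a, 'b) monoid_scheme \<Rightarrow> 'a set \<Rightarrow> 'a \<Rightarrow> 'a \<Rightarrow> bool" where
  "bruhat_step G S u w \<longleftrightarrow> u \<in> carrier G \<and> w \<in> carrier G \<and>
     (\<exists>t\<in>reflections G S. w = u \<otimes>\<^bsub>G\<^esub> t) \<and> word_length G S u < word_length G S w"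

definition bruhat_le :: "('a, 'b) monoid_scheme \<Rightarrow> 'a set \<Rightarrow> 'a \<Rightarrow> 'a \<Rightarrow> bool" where
  "bruhat_le G S = (bruhat_step G S)\<^sup>*\<^sup>*"

definition longest_element :: "('a, 'b) monoid_scheme \<Rightarrow> 'a set \<Rightarrow> 'a set \<Rightarrow> 'a" where
  "longest_element G S P = (THE w. w \<in> P \<and> (\<forall>x\<in>P. word_length G S x \<le> word_length G S w))"

definition bruhat_maximal :: "('a, 'b) monoid_scheme \<Rightarrow> 'a set \<Rightarrow> 'a set \<Rightarrow> 'a" where
  "bruhat_maximal G S p = (THE w. w \<in> p \<and> (\<forall>x\<in>p. bruhat_le G S w x \<longrightarrow> x = w))"

definition double_cosets ::
    "('a, 'b) monoid_scheme \<Rightarrow> 'a set \<Rightarrow> 'a set \<Rightarrow> 'a set set" where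
  "double_cosets G H K = {(H #>\<^bsub>G\<^esub> x) <#>\<^bsub>G\<^esub> K | x. x \<in> carrier G}"


section \<open>The affine Weyl group\<close>

definition affine_weyl :: "nat \<Rightarrow> (int \<Rightarrow> int) monoid" where
  "affine_weyl n =
     \<lparr> carrier = {w. bij w \<and> (\<forall>i. w (i + int n) = w i + int n) \<and>
                     (\<Sum>i = 1..int n. w i) = (\<Sum>i = 1..int n. i)},
       monoid.mult = (\<circ>), one = id \<rparr>"

text \<open>
  The index set \<open>\<int>/n\<int>\<close> is handled by integer representatives: \<open>simple_refl n k\<close>,
  \<open>hat n k\<close> and \<open>parabolic n k\<close> depend only on \<open>k\<close> modulo \<open>n\<close>.
\<close>

definition simple_refl :: "nat \<Rightarrow> int \<Rightarrow> int \<Rightarrow> int" where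
  "simple_refl n k = (\<lambda>j. if [j = k] (mod int n) then j + 1
                          else if [j = k + 1] (mod int n) then j - 1 else j)"

definition simple_refls :: "nat \<Rightarrow> (int \<Rightarrow> int) set" where
  "simple_refls n = range (simple_refl n)"

definition hat :: "nat \<Rightarrow> int \<Rightarrow> (int \<Rightarrow> int) set" where
  "hat n k = simple_refls n - {simple_refl n k}"

definition parabolic :: "nat \<Rightarrow> int \<Rightarrow> (int \<Rightarrow> int) set" where
  "parabolic n k = generate (affine_weyl n) (hat n k)"

definition w_hat :: "nat \<Rightarrow> int \<Rightarrow> int \<Rightarrow> int" where
  "w_hat n k = longest_element (affine_weyl n) (simple_refls n) (parabolic n k)"

definition max_elt :: "nat \<Rightarrow> (int \<Rightarrow> int) set \<Rightarrow> int \<Rightarrow> int" where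
  "max_elt n p = bruhat_maximal (affine_weyl n) (simple_refls n) p"

definition weyl_double_cosets :: "nat \<Rightarrow> int \<Rightarrow> (int \<Rightarrow> int) set set" where
  "weyl_double_cosets n k = double_cosets (affine_weyl n) (parabolic n k) (parabolic n 0)"

definition coset_coproduct :: "nat \<Rightarrow> (int \<times> (int \<Rightarrow> int) set) set" where
  "coset_coproduct n = Sigma {0..<int n} (weyl_double_cosets n)"

definition coset_elt :: "nat \<Rightarrow> (int \<Rightarrow> int) set \<Rightarrow> int \<Rightarrow> int" where
  "coset_elt n p = max_elt n p \<otimes>\<^bsub>affine_weyl n\<^esub> w_hat n 0"


section \<open>Dominant weights of \<open>sl\<^sub>n\<close>\<close>

text \<open>
  Weights are given by their coordinates with respect to \<open>\<epsilon>\<^sub>1, \<dots>, \<epsilon>\<^sub>n\<close>, normalised to have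
  coordinate sum zero; thus \<open>fund_weight n j\<close> is
  \<open>\<epsilon>\<^sub>1 + \<dots> + \<epsilon>\<^sub>j - (j/n) (\<epsilon>\<^sub>1 + \<dots> + \<epsilon>\<^sub>n)\<close>.
  Coordinates outside \<open>{1..n}\<close> are set to zero.
\<close>

type_synonym weight = "nat \<Rightarrow> real"

definition fund_weight :: "nat \<Rightarrow> nat \<Rightarrow> weight" where
  "fund_weight n j =
     (\<lambda>i. if i \<in> {1..n} then (if i \<le> j then 1 else 0) - real j / real n else 0)"

definition weight_comb :: "nat \<Rightarrow> (nat \<Rightarrow> int) \<Rightarrow> weight" where
  "weight_comb n g = (\<lambda>x. \<Sum>j = 1..<n. of_int (g j) * fund_weight n j x)"

definition dominant_weights :: "nat \<Rightarrow> weight set" where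
  "dominant_weights n = {weight_comb n (\<lambda>j. int (g j)) | g :: nat \<Rightarrow> nat. True}"

text \<open>
  The value of \<open>sh\<close> is the representative in \<open>{0..<n}\<close> of an element of \<open>\<int>/n\<int>\<close>; it is well
  defined because the fundamental weights are linearly independent.
\<close>

definition sh :: "nat \<Rightarrow> weight \<Rightarrow> int" where
  "sh n lam = (THE r. \<exists>g :: nat \<Rightarrow> nat. lam = weight_comb n (\<lambda>j. int (g j)) \<and>
                        r = (\<Sum>j = 1..<n. int j * int (g j)) mod int n)"


section \<open>The bijection\<close>

definition shift_coeff :: "nat \<Rightarrow> int \<Rightarrow> (int \<Rightarrow> int) set \<Rightarrow> nat \<Rightarrow> int" where
  "shift_coeff n k p i = (THE c. coset_elt n p (int i) = k + int i + c * int n)"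

definition coset_weight :: "nat \<Rightarrow> int \<times> (int \<Rightarrow> int) set \<Rightarrow> weight" where
  "coset_weight n = (\<lambda>(k, p).
     weight_comb n (\<lambda>i. shift_coeff n k p (i + 1) - shift_coeff n k p i))"

definition psi0 :: "nat \<Rightarrow> weight \<Rightarrow> int \<times> (int \<Rightarrow> int) set" where
  "psi0 n = restrict (the_inv_into (coset_coproduct n) (coset_weight n)) (dominant_weights n)"

end

theory Submission
  imports Defs "HOL-Library.Multiset"
begin

text \<open>
  On the affine symmetric group the word length counts inversions, so multiplying by a simple
  reflection at an ascent, on either side, is an upward Bruhat step. Inside a double coset such
  steps can be continued until an element \<open>e\<close> has descents at all generators of both parabolics.
  These descents force \<open>e i = k + n + 1 - i + c\<^sub>i n\<close> with \<open>c\<close> antitone on \<open>{1..n}\<close>. Since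
  the multiset of the \<open>c\<^sub>i\<close> is an invariant of the double coset, \<open>e\<close> is unique, hence it is
  the Bruhat maximum. Multiplying by the longest element \<open>i \<mapsto> n + 1 - i\<close> of the finite
  parabolic yields the increasing representative, whose consecutive differences of \<open>c\<close>
  are the coordinates of the weight; the normalisation of the coordinate sum of elements
  of the group fixes \<open>c\<^sub>1\<close> and \<open>k\<close>.
\<close>

locale affine_perm =
  fixes n :: nat
  assumes n_ge_2: "2 \<le> n"
begin

abbreviation N :: int where "N \<equiv> int n"
abbreviation W :: "(int \<Rightarrow> int) monoid" where "W \<equiv> affine_weyl n"

section \<open>The group of periodic bijections and the window \<open>{1..N}\<close>\<close>

lemma N_pos: "0 < N" and N_ge_2: "2 \<le> N"
  using n_ge_2 by auto

lemma mult_W [simp]: "x \<otimes>\<^bsub>W\<^esub> y = x \<circ> y"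
  and one_W [simp]: "\<one>\<^bsub>W\<^esub> = id"
  by (simp_all add: affine_weyl_def)

lemma carrier_iff:
  "w \<in> carrier W \<longleftrightarrow> bij w \<and> (\<forall>i. w (i + N) = w i + N) \<and> (\<Sum>i = 1..N. w i) = (\<Sum>i = 1..N. i)"
  by (simp add: affine_weyl_def)

text \<open>The increment \<open>a\<close> covers two cases: \<open>a = N\<close> for group
  elements, and \<open>a = 0\<close> for functions constant on residue classes.\<close>

lemma shift_mult:
  assumes "\<And>i. f (i + N) = f i + (a :: int)"
  shows "f (i + q * N) = f i + q * a"
proof -
  have nat_case: "f (j + int m * N) = f j + int m * a" for m j
  proof (induction m)
    case (Suc m)
    then show ?case using assms[of "j + int m * N"] by (simp add: algebra_simps)
  qed simp
  show ?thesis
  proof (cases "0 \<le> q")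
    case True
    then show ?thesis using nat_case[of i "nat q"] by simp
  next
    case False
    then show ?thesis using nat_case[of "i + q * N" "nat (- q)"] by simp
  qed
qed

lemma window_div: "z - (z - 1) div N * N \<in> {1..N}"
proof -
  have "0 \<le> (z - 1) mod N" "(z - 1) mod N < N" using N_pos by auto
  moreover have "(z - 1) div N * N + (z - 1) mod N = z - 1" by simp
  ultimately show ?thesis unfolding atLeastAtMost_iff by linarith
qed

lemma window_rep:
  obtains q where "(i::int) - q * N \<in> {1..N}"
  using window_div by blast

lemma window_unique:
  assumes "(a::int) \<in> {1..N}" "b \<in> {1..N}" "a = b + q * N"
  shows "q = 0"
proof -
  have "q * N < 1 * N" "(-1) * N < q * N"
    using assms unfolding atLeastAtMost_iff by linarith+
  then have "q < 1" "-1 < q" using N_pos by (meson mult_right_less_imp_less order_less_imp_le)+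
  then show ?thesis by simp
qed

text \<open>A periodic bijection permutes the residue classes modulo \<open>N\<close>, and
  \<open>f\<close> sees only the residue class. This is what makes the normalisation of the
  coordinate sum stable under products and inverses.\<close>

lemma sum_periodic_perm:
  assumes f: "\<And>i. f (i + N) = (f i :: int)" and w: "bij w" "\<And>i. w (i + N) = w i + N"
  shows "(\<Sum>i = 1..N. f (w i)) = (\<Sum>i = 1..N. f i)"
proof -
  \<comment> \<open>\<open>d i\<close> is the number of the translated window that contains
    \<open>w i\<close>, and \<open>r i\<close> is the representative of \<open>w i\<close> in
    \<open>{1..N}\<close>.\<close>
  define d where "d i = (w i - 1) div N" for i
  define r where "r i = w i - d i * N" for i
  have r_in: "r i \<in> {1..N}" for i
    unfolding r_def d_def by (rule window_div)
  have "inj_on r {1..N}"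
  proof (rule inj_onI)
    fix i j assume ij: "i \<in> {1..N}" "j \<in> {1..N}" and eq: "r i = r j"
    have "w i = w j + (d i - d j) * N"
      using eq by (simp add: r_def algebra_simps)
    also have "\<dots> = w (j + (d i - d j) * N)" using shift_mult[of w N j] w(2) by simp
    finally have "i = j + (d i - d j) * N" using w(1) by (auto simp: bij_def dest: injD)
    then show "i = j" using window_unique[OF ij, of "d i - d j"] by simp
  qed
  then have bij: "bij_betw r {1..N} {1..N}"
    by (simp add: bij_betw_def endo_inj_surj r_in image_subsetI del: atLeastAtMost_iff)
  have "f (r i) = f (w i)" for i
    using shift_mult[of f 0 "r i" "d i"] f by (simp add: r_def)
  then show ?thesis using sum.reindex_bij_betw[OF bij, of f] by simp
qed

text \<open>The normalisation is restated as a vanishing sum of displacements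
  \<open>w i - i\<close>: these are periodic, whereas the values \<open>w i\<close> are not, so
  their sum can be reindexed.\<close>

lemma carrierD:
  assumes "w \<in> carrier W"
  shows "bij w" "w (i + N) = w i + N" "w (i + q * N) = w i + q * N"
    "(\<Sum>i = 1..N. w i - i) = 0"
proof -
  show "bij w" and p: "w (i + N) = w i + N" for i
    using assms by (auto simp: carrier_iff)
  show "w (i + q * N) = w i + q * N"
    using shift_mult[of w N] p by simp
  show "(\<Sum>i = 1..N. w i - i) = 0"
    using assms by (simp add: carrier_iff sum_subtractf)
qed

lemma carrierI:
  assumes "bij w" "\<And>i. w (i + N) = w i + N" "(\<Sum>i = 1..N. w i - i) = 0"
  shows "w \<in> carrier W"
  using assms by (simp add: carrier_iff sum_subtractf)

lemma carrier_ext: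
  assumes "v \<in> carrier W" "w \<in> carrier W" "\<And>i. i \<in> {1..N} \<Longrightarrow> v i = w i"
  shows "v = w"
proof
  fix i
  obtain q where "i - q * N \<in> {1..N}" by (rule window_rep)
  then have "v (i - q * N + q * N) = w (i - q * N + q * N)"
    using assms(3) carrierD(3)[OF assms(1)] carrierD(3)[OF assms(2)] by presburger
  then show "v i = w i" by simp
qed

lemma comp_carrier:
  assumes "v \<in> carrier W" "w \<in> carrier W"
  shows "v \<circ> w \<in> carrier W"
proof (rule carrierI)
  note v = carrierD[OF assms(1)] and w = carrierD[OF assms(2)]
  show "bij (v \<circ> w)" using v(1) w(1) bij_comp by blast
  show "(v \<circ> w) (i + N) = (v \<circ> w) i + N" for i by (simp add: v(2) w(2))
  \<comment> \<open>The displacement of \<open>v \<circ> w\<close> at \<open>i\<close> is that of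
    \<open>v\<close> at \<open>w i\<close> plus that of \<open>w\<close> at
    \<open>i\<close>.\<close>
  have "(\<Sum>i = 1..N. v (w i) - w i) = (\<Sum>i = 1..N. v i - i)"
    by (rule sum_periodic_perm[of "\<lambda>i. v i - i"]) (use v(2) w(1,2) in auto)
  then show "(\<Sum>i = 1..N. (v \<circ> w) i - i) = 0"
    using v(4) w(4) by (simp add: sum_subtractf)
qed

lemma inv_carrier:
  assumes "w \<in> carrier W"
  shows "Hilbert_Choice.inv w \<in> carrier W"
proof (rule carrierI)
  note w = carrierD[OF assms]
  let ?v = "Hilbert_Choice.inv w"
  show "bij ?v" using w(1) bij_imp_bij_inv by blast
  show p: "?v (i + N) = ?v i + N" for i
    by (metis w(1,2) bij_inv_eq_iff)
  have "(\<Sum>i = 1..N. ?v (w i) - w i) = (\<Sum>i = 1..N. ?v i - i)"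
    by (rule sum_periodic_perm[of "\<lambda>i. ?v i - i"]) (use p w(1,2) in auto)
  then show "(\<Sum>i = 1..N. ?v i - i) = 0"
    using w(1,4) by (simp add: bij_is_inj sum_subtractf)
qed

sublocale W: group W
proof (rule groupI)
  show "\<one>\<^bsub>W\<^esub> \<in> carrier W" by (simp add: carrier_iff)
  show "\<exists>y\<in>carrier W. y \<otimes>\<^bsub>W\<^esub> x = \<one>\<^bsub>W\<^esub>" if "x \<in> carrier W" for x
    using inv_carrier[OF that] carrierD(1)[OF that]
    by (intro bexI[of _ "Hilbert_Choice.inv x"]) (auto simp: bij_is_inj)
qed (auto simp: comp_carrier comp_assoc)

lemma id_carrier: "id \<in> carrier W"
  by (simp add: carrier_iff)

lemma inv_W:
  assumes "w \<in> carrier W"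
  shows "inv\<^bsub>W\<^esub> w = Hilbert_Choice.inv w"
  by (rule W.inv_equality) (use assms inv_carrier carrierD(1)[OF assms] in \<open>auto simp: bij_is_inj\<close>)

subsection \<open>Simple reflections\<close>

lemma cong_iff_mult: "[a = b] (mod N) \<longleftrightarrow> (\<exists>q. a = b + q * N)"
  by (metis add.commute cong_iff_lin cong_sym mult.commute)

lemma not_cong_succ: "\<not> [k = k + 1] (mod N)" "\<not> [k + 1 = k] (mod N)"
proof -
  have "\<not> N dvd 1" using N_ge_2 by (auto dest: zdvd_imp_le)
  then show "\<not> [k = k + 1] (mod N)" "\<not> [k + 1 = k] (mod N)"
    by (auto simp: cong_iff_dvd_diff)
qed

lemma cong_shift: "[a + N = b] (mod N) \<longleftrightarrow> [a = b] (mod N)"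
  by (simp add: cong_def)

lemma simple_refl_invol: "simple_refl n k (simple_refl n k j) = j"
proof -
  have "[j = k] (mod N) \<Longrightarrow> [j + 1 = k + 1] (mod N)" by (simp add: cong_add)
  moreover have "[j = k + 1] (mod N) \<Longrightarrow> [j - 1 = k] (mod N)"
    using cong_diff[of j "k + 1" N 1 1] by simp
  moreover have "[j = k] (mod N) \<Longrightarrow> [j + 1 = k] (mod N) \<Longrightarrow> False"
    using not_cong_succ by (meson calculation(1) cong_sym cong_trans)
  ultimately show ?thesis by (auto simp: simple_refl_def)
qed

lemma simple_refl_comp [simp]: "simple_refl n k \<circ> simple_refl n k = id"
  by (auto simp: simple_refl_invol)

lemma simple_refl_shift: "simple_refl n k (i + N) = simple_refl n k i + N"
  by (simp add: simple_refl_def cong_shift)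

lemma simple_refl_eqs:
  "simple_refl n k (k + q * N) = k + q * N + 1" "simple_refl n k (k + 1 + q * N) = k + q * N"
proof -
  have "[k + q * N = k] (mod N)" "[k + 1 + q * N = k + 1] (mod N)" by (simp_all add: cong_def)
  moreover from this(2) have "\<not> [k + 1 + q * N = k] (mod N)"
    using not_cong_succ by (meson cong_sym cong_trans)
  ultimately show "simple_refl n k (k + q * N) = k + q * N + 1"
    "simple_refl n k (k + 1 + q * N) = k + q * N"
    by (simp_all add: simple_refl_def)
qed

lemma simple_refl_carrier: "simple_refl n k \<in> carrier W"
proof (rule carrierI)
  show "bij (simple_refl n k)"
    by (rule o_bij[of "simple_refl n k"]) simp_all
  show "simple_refl n k (i + N) = simple_refl n k i + N" for i
    by (rule simple_refl_shift)
  \<comment> \<open>The displacement is 1 on the class of \<open>k\<close> and -1 on that of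
    \<open>k + 1\<close>: an indicator minus its translate, so its sum over a window
    cancels.\<close>
  define e :: "int \<Rightarrow> int" where "e i = (if [i = k] (mod N) then 1 else 0)" for i
  have "simple_refl n k i - i = e i - e (i - 1)" for i
  proof -
    have "[i = k + 1] (mod N) \<longleftrightarrow> [i - 1 = k] (mod N)"
      by (simp add: cong_iff_dvd_diff algebra_simps)
    moreover have "[i = k] (mod N) \<Longrightarrow> \<not> [i = k + 1] (mod N)"
      using not_cong_succ by (meson cong_sym cong_trans)
    ultimately show ?thesis by (auto simp: simple_refl_def e_def)
  qed
  moreover have "(\<Sum>i = 1..N. e (i - 1)) = (\<Sum>i = 1..N. e i)"
  proof (rule sum_periodic_perm)
    show "bij (\<lambda>i::int. i - 1)" by (rule o_bij[of "\<lambda>i. i + 1"]) auto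
  qed (auto simp: e_def cong_shift)
  ultimately show "(\<Sum>i = 1..N. simple_refl n k i - i) = 0"
    by (simp add: sum_subtractf)
qed

lemma inv_simple_refl: "inv\<^bsub>W\<^esub> (simple_refl n k) = simple_refl n k"
  by (rule W.inv_equality) (simp_all add: simple_refl_carrier)

lemma simple_refls_carrier: "simple_refls n \<subseteq> carrier W"
  by (auto simp: simple_refls_def simple_refl_carrier)

subsection \<open>Inversions and word length\<close>

text \<open>Inverted pairs come in orbits under simultaneous translation by \<open>N\<close>.
  Confining the first entry to the window picks one pair from each orbit and makes the set
  finite.\<close>

definition inversions :: "(int \<Rightarrow> int) \<Rightarrow> (int \<times> int) set" where
  "inversions w = {(i, j). i \<in> {1..N} \<and> i < j \<and> w j < w i}"

lemma displacement_bound: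
  assumes "w \<in> carrier W" "\<And>i. i \<in> {1..N} \<Longrightarrow> \<bar>w i - i\<bar> \<le> M"
  shows "\<bar>w i - i\<bar> \<le> M"
proof -
  obtain q where "i - q * N \<in> {1..N}" by (rule window_rep)
  from assms(2)[OF this] show ?thesis
    using carrierD(3)[OF assms(1), of "i - q * N" q] by simp
qed

lemma displacement_bounded:
  assumes "w \<in> carrier W"
  obtains M where "\<And>i. \<bar>w i - i\<bar> \<le> M"
proof
  fix i
  show "\<bar>w i - i\<bar> \<le> Max ((\<lambda>i. \<bar>w i - i\<bar>) ` {1..N})"
    by (rule displacement_bound[OF assms]) (simp del: atLeastAtMost_iff)
qed

lemma inversions_bounded:
  assumes "\<And>i. \<bar>w i - i\<bar> \<le> M"
  shows "inversions w \<subseteq> {1..N} \<times> {1..N + 2 * M}"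
proof
  fix x assume "x \<in> inversions w"
  then obtain i j where x: "x = (i, j)" "i \<in> {1..N}" "i < j" "w j < w i"
    by (auto simp: inversions_def)
  then show "x \<in> {1..N} \<times> {1..N + 2 * M}" using assms[of i] assms[of j] by auto
qed

lemma finite_inversions:
  assumes "w \<in> carrier W"
  shows "finite (inversions w)"
proof -
  obtain M where "\<And>i. \<bar>w i - i\<bar> \<le> M" using displacement_bounded[OF assms] by blast
  from inversions_bounded[OF this] show ?thesis by (rule finite_subset) simp
qed

lemma inversions_id [simp]: "inversions id = {}" "inversions (\<lambda>i. i) = {}"
  by (auto simp: inversions_def)

text \<open>The representative of a translation orbit of pairs that \<open>inversions\<close>
  uses.\<close>

definition to_window :: "int \<times> int \<Rightarrow> int \<times> int" where
  "to_window = (\<lambda>(a, b). (a - (a - 1) div N * N, b - (a - 1) div N * N))"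

lemma to_window_cases:
  obtains q where "to_window (a, b) = (a - q * N, b - q * N)" "a - q * N \<in> {1..N}"
proof
  show "to_window (a, b) = (a - (a - 1) div N * N, b - (a - 1) div N * N)"
    by (simp add: to_window_def)
qed (rule window_div)

lemma to_window_shift:
  assumes "a \<in> {1..N}"
  shows "to_window (a + q * N, b + q * N) = (a, b)"
proof -
  obtain r where r: "to_window (a + q * N, b + q * N) = (a + q * N - r * N, b + q * N - r * N)"
      "a + q * N - r * N \<in> {1..N}"
    by (rule to_window_cases)
  have "q - r = 0" by (rule window_unique[OF r(2) assms]) (simp add: algebra_simps)
  then show ?thesis using r(1) by simp
qed

text \<open>A simple reflection moves each number by at most one, so only gaps 1 and 2 matter. At
  gap 2 an order failure would need \<open>a\<close> and \<open>a + 1\<close> both congruent to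
  \<open>k\<close>.\<close>

lemma simple_refl_mono:
  assumes "a < b" "\<not> ([a = k] (mod N) \<and> b = a + 1)"
  shows "simple_refl n k a < simple_refl n k b"
proof -
  let ?s = "simple_refl n k"
  have a: "?s a \<le> a + 1" "\<not> [a = k] (mod N) \<Longrightarrow> ?s a \<le> a"
    by (simp_all add: simple_refl_def)
  have b: "b - 1 \<le> ?s b" "\<not> [b = k + 1] (mod N) \<Longrightarrow> b \<le> ?s b"
    by (simp_all add: simple_refl_def)
  have pred: "[b - 1 = k] (mod N)" if "[b = k + 1] (mod N)"
    using cong_diff[OF that, of 1 1] by simp
  consider "b = a + 1" | "b = a + 2" | "a + 2 < b" using assms(1) by linarith
  then show ?thesis
  proof cases
    case 1
    then have "\<not> [a = k] (mod N)" "\<not> [b = k + 1] (mod N)" using assms(2) pred by auto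
    then show ?thesis using a(2) b(2) 1 by linarith
  next
    case 2
    then have "b - 1 = a + 1" by simp
    then have "\<not> ([a = k] (mod N) \<and> [b = k + 1] (mod N))"
      using pred not_cong_succ(1)[of a] by (metis cong_sym cong_trans)
    then show ?thesis using a b 2 by linarith
  next
    case 3
    then show ?thesis using a(1) b(1) by linarith
  qed
qed

text \<open>Applying \<open>s\<close> to both entries of a pair carries the inversions of
  \<open>w\<close> to those of \<open>w \<circ> s\<close>, except that the orbit of
  \<open>(k, k + 1)\<close> is new.\<close>

lemma card_inversions_ascent:
  assumes w: "w \<in> carrier W" and asc: "w k < w (k + 1)"
  shows "card (inversions (w \<circ> simple_refl n k)) = Suc (card (inversions w))"
proof -
  define s where "s = simple_refl n k"
  define t where "t = to_window (k, k + 1)"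
  \<comment> \<open>\<open>t\<close> represents the new orbit. \<open>\<phi>\<close> is its own
    inverse on pairs with first entry in the window, so one map serves in both directions.\<close>
  define \<phi> where "\<phi> = (\<lambda>(a, b). to_window (s a, s b))"
  have s: "s \<in> carrier W" and ss: "s (s j) = j" for j
    by (simp_all add: s_def simple_refl_carrier simple_refl_invol)
  have ws: "w \<circ> s \<in> carrier W" using w s by (rule comp_carrier)
  note shift_s = carrierD(3)[OF s] and shift_w = carrierD(3)[OF w]
  have asc': "w (k + q * N) < w (k + 1 + q * N)" for q
    using asc shift_w[of k q] shift_w[of "k + 1" q] by simp
  obtain qt where t: "t = (k - qt * N, k + 1 - qt * N)" "k - qt * N \<in> {1..N}"
    unfolding t_def by (rule to_window_cases)
  have t_in: "t \<in> inversions (w \<circ> s)"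
  proof -
    have "s (k - qt * N) = k + 1 - qt * N" "s (k + 1 - qt * N) = k - qt * N"
      using simple_refl_eqs[of k "- qt"] by (simp_all add: s_def)
    moreover have "w (k - qt * N) < w (k + 1 - qt * N)" using asc'[of "- qt"] by simp
    ultimately show ?thesis using t by (simp add: inversions_def)
  qed
  have inv_phi: "\<phi> (\<phi> (a, b)) = (a, b)" if "a \<in> {1..N}" for a b
  proof -
    obtain q where q: "\<phi> (a, b) = (s a - q * N, s b - q * N)"
      unfolding \<phi>_def prod.case by (rule to_window_cases)
    then have "\<phi> (\<phi> (a, b)) = to_window (a + (- q) * N, b + (- q) * N)"
      using shift_s[of "s a" "- q"] shift_s[of "s b" "- q"] ss by (simp add: \<phi>_def)
    then show ?thesis using that by (simp only: to_window_shift)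
  qed
  have phi_in: "\<phi> (a, b) \<in> inversions (v \<circ> s)"
    if v: "v \<in> carrier W" and lt: "v b < v a" "s a < s b" for v a b
  proof -
    obtain q where q: "\<phi> (a, b) = (s a - q * N, s b - q * N)" "s a - q * N \<in> {1..N}"
      unfolding \<phi>_def prod.case by (rule to_window_cases)
    have "v (s (s a + (- q) * N)) = v a + (- q) * N" "v (s (s b + (- q) * N)) = v b + (- q) * N"
      by (simp_all only: shift_s carrierD(3)[OF v] ss)
    then show ?thesis using q lt by (simp add: inversions_def)
  qed
  have "bij_betw \<phi> (inversions w) (inversions (w \<circ> s) - {t})"
  proof (rule bij_betw_byWitness[where f' = \<phi>])
    show "\<forall>x\<in>inversions w. \<phi> (\<phi> x) = x"
      "\<forall>x\<in>inversions (w \<circ> s) - {t}. \<phi> (\<phi> x) = x"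
      using inv_phi by (auto simp: inversions_def)
    show "\<phi> ` inversions w \<subseteq> inversions (w \<circ> s) - {t}"
    proof (rule image_subsetI)
      fix x assume "x \<in> inversions w"
      then obtain a b where x_eq: "x = (a, b)" and ab: "a \<in> {1..N}" "a < b" "w b < w a"
        by (auto simp: inversions_def)
      \<comment> \<open>Such a pair would be a translate of \<open>(k, k + 1)\<close>, where
        \<open>w\<close> ascends.\<close>
      have "\<not> ([a = k] (mod N) \<and> b = a + 1)"
      proof (clarify)
        assume "[a = k] (mod N)" "b = a + 1"
        then obtain q where "a = k + q * N" "b = k + 1 + q * N" by (auto simp: cong_iff_mult)
        then show False using asc'[of q] ab(3) by simp
      qed
      then have "s a < s b" unfolding s_def by (rule simple_refl_mono[OF ab(2)])
      then have "\<phi> (a, b) \<in> inversions (w \<circ> s)" using w ab by (intro phi_in) auto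
      moreover have "\<phi> (a, b) \<noteq> t"
      proof
        assume eq: "\<phi> (a, b) = t"
        obtain q where q: "\<phi> (a, b) = (s a - q * N, s b - q * N)"
          unfolding \<phi>_def prod.case by (rule to_window_cases)
        \<comment> \<open>Undoing \<open>s\<close> turns this into a translate of
          \<open>(k + 1, k)\<close>, against \<open>a < b\<close>.\<close>
        have "s a = k + (q - qt) * N" "s b = k + 1 + (q - qt) * N"
          using eq q t by (auto simp: algebra_simps)
        then have "a = k + (q - qt) * N + 1" "b = k + (q - qt) * N"
          using ss[of a] ss[of b] simple_refl_eqs[of k "q - qt"] by (simp_all add: s_def)
        then show False using ab by simp
      qed
      ultimately show "\<phi> x \<in> inversions (w \<circ> s) - {t}" by (simp add: x_eq)
    qed
    show "\<phi> ` (inversions (w \<circ> s) - {t}) \<subseteq> inversions w"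
    proof (rule image_subsetI)
      fix x assume x: "x \<in> inversions (w \<circ> s) - {t}"
      obtain a b where x_eq: "x = (a, b)" by fastforce
      have nt: "(a, b) \<noteq> t" and ab: "a \<in> {1..N}" "a < b" "(w \<circ> s) b < (w \<circ> s) a"
        using x by (auto simp: x_eq inversions_def)
      have "\<not> ([a = k] (mod N) \<and> b = a + 1)"
      proof (clarify)
        assume "[a = k] (mod N)" and b: "b = a + 1"
        then obtain q where q: "a = k + q * N" by (auto simp: cong_iff_mult)
        \<comment> \<open>Two translates of \<open>(k, k + 1)\<close> with first entry in the window
          coincide, so the pair would be \<open>t\<close>, which was removed.\<close>
        have "q + qt = 0"
          by (rule window_unique[OF ab(1) t(2)]) (simp add: q algebra_simps)
        then have "q = - qt" by simp
        then show False using nt t b q by simp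
      qed
      then have "s a < s b" unfolding s_def by (rule simple_refl_mono[OF ab(2)])
      then have "\<phi> (a, b) \<in> inversions ((w \<circ> s) \<circ> s)" using ws ab by (intro phi_in) auto
      then show "\<phi> x \<in> inversions w" by (simp add: x_eq comp_assoc s_def)
    qed
  qed
  then have "card (inversions w) = card (inversions (w \<circ> s) - {t})"
    by (rule bij_betw_same_card)
  then show ?thesis
    using card_Suc_Diff1[OF finite_inversions[OF ws] t_in] by (simp only: s_def)
qed

lemma card_inversions_descent:
  assumes w: "w \<in> carrier W" and desc: "w (k + 1) < w k"
  shows "card (inversions w) = Suc (card (inversions (w \<circ> simple_refl n k)))"
proof -
  have "card (inversions ((w \<circ> simple_refl n k) \<circ> simple_refl n k))
      = Suc (card (inversions (w \<circ> simple_refl n k)))"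
    using desc simple_refl_eqs[of k 0]
    by (intro card_inversions_ascent comp_carrier w simple_refl_carrier) simp
  then show ?thesis by (simp add: comp_assoc)
qed

lemma neq_succ: "w \<in> carrier W \<Longrightarrow> w i \<noteq> w (i + 1)"
  using carrierD(1)[of w] by (auto simp: bij_def dest: injD)

text \<open>Strict growth makes \<open>w i - i\<close> weakly increasing. Being periodic as well, it
  is constant, and the normalisation makes the constant zero.\<close>

lemma no_descent_id:
  assumes w: "w \<in> carrier W" and asc: "\<And>i. w i < w (i + 1)"
  shows "w = id"
proof -
  have mono: "w i - i \<le> w (i + int m) - (i + int m)" for i m
  proof (induction m)
    case (Suc m)
    then show ?case using asc[of "i + int m"] by (simp add: algebra_simps)
  qed simp
  have const: "w i - i = w 1 - 1" if "i \<in> {1..N}" for i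
    using mono[of 1 "nat (i - 1)"] mono[of i "nat (N + 1 - i)"] that carrierD(2)[OF w, of 1]
    by (simp add: algebra_simps)
  have "(\<Sum>i = 1..N. w i - i) = (\<Sum>i = 1..N. w 1 - 1)"
    by (rule sum.cong[OF refl const])
  then have "w 1 - 1 = 0" using carrierD(4)[OF w] N_pos by simp
  then show ?thesis
    using const by (intro carrier_ext w) (auto simp: carrier_iff)
qed

section \<open>Words in the simple reflections and the length function\<close>

definition word_prod :: "(int \<Rightarrow> int) list \<Rightarrow> int \<Rightarrow> int" where
  "word_prod ss = foldr (\<circ>) ss id"

abbreviation len :: "(int \<Rightarrow> int) \<Rightarrow> nat" where
  "len w \<equiv> word_length W (simple_refls n) w"

lemma word_prod_Nil [simp]: "word_prod [] = id"
  and word_prod_Cons [simp]: "word_prod (s # ss) = s \<circ> word_prod ss"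
  by (simp_all add: word_prod_def)

lemma word_prod_append [simp]: "word_prod (xs @ ys) = word_prod xs \<circ> word_prod ys"
  by (induction xs) (simp_all add: comp_assoc)

lemma word_prod_carrier: "set ss \<subseteq> simple_refls n \<Longrightarrow> word_prod ss \<in> carrier W"
  by (induction ss) (use simple_refls_carrier comp_carrier W.one_closed in auto)

lemma card_inversions_le_word:
  assumes "set ss \<subseteq> simple_refls n"
  shows "card (inversions (word_prod ss)) \<le> length ss"
  using assms
proof (induction ss rule: rev_induct)
  case Nil
  then show ?case by simp
next
  case (snoc s ss)
  let ?w = "word_prod ss"
  obtain k where k: "s = simple_refl n k" using snoc.prems by (auto simp: simple_refls_def)
  have w: "?w \<in> carrier W" using snoc.prems by (intro word_prod_carrier) auto
  have "card (inversions (?w \<circ> s)) \<le> Suc (card (inversions ?w))"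
    using card_inversions_ascent[OF w, of k] card_inversions_descent[OF w, of k]
      neq_succ[OF w, of k] k by fastforce
  moreover have "card (inversions ?w) \<le> length ss" using snoc.prems by (intro snoc.IH) simp
  ultimately show ?case
    unfolding word_prod_append word_prod_Cons word_prod_Nil comp_id length_append_singleton
    by linarith
qed

text \<open>Sorting: right multiplication at a descent removes exactly one inversion, and only the
  identity has no descent.\<close>

lemma reduced_word:
  assumes "w \<in> carrier W"
  shows "\<exists>ss. length ss = card (inversions w) \<and> set ss \<subseteq> simple_refls n \<and> word_prod ss = w"
  using assms
proof (induction "card (inversions w)" arbitrary: w rule: less_induct)
  case less
  show ?case
  proof (cases "\<forall>i. w i < w (i + 1)")
    case True
    then have "w = id" using less.prems no_descent_id by blast
    then show ?thesis by (intro exI[of _ "[]"]) simp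
  next
    case False
    then obtain k where "w (k + 1) < w k"
      using neq_succ[OF less.prems] by (meson linorder_neqE_linordered_idom)
    note c = card_inversions_descent[OF less.prems this]
    have "w \<circ> simple_refl n k \<in> carrier W"
      by (intro comp_carrier less.prems simple_refl_carrier)
    with less.hyps c obtain ss where ss: "length ss = card (inversions (w \<circ> simple_refl n k))"
      "set ss \<subseteq> simple_refls n" "word_prod ss = w \<circ> simple_refl n k"
      by (metis lessI)
    then show ?thesis
      using c by (intro exI[of _ "ss @ [simple_refl n k]"])
        (auto simp: comp_assoc simple_refls_def)
  qed
qed

lemma word_length_eq:
  assumes "w \<in> carrier W"
  shows "len w = card (inversions w)"
  unfolding word_length_def
proof (rule Least_equality)
  have eq: "foldr (\<lambda>x y. x \<otimes>\<^bsub>W\<^esub> y) ss \<one>\<^bsub>W\<^esub> = word_prod ss" for ss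
    by (induction ss) simp_all
  show "\<exists>ss. length ss = card (inversions w) \<and> set ss \<subseteq> simple_refls n \<and>
      foldr (\<lambda>x y. x \<otimes>\<^bsub>W\<^esub> y) ss \<one>\<^bsub>W\<^esub> = w"
    unfolding eq using reduced_word[OF assms] by blast
  show "card (inversions w) \<le> m"
    if "\<exists>ss. length ss = m \<and> set ss \<subseteq> simple_refls n \<and>
      foldr (\<lambda>x y. x \<otimes>\<^bsub>W\<^esub> y) ss \<one>\<^bsub>W\<^esub> = w" for m
    using that card_inversions_le_word unfolding eq by blast
qed

lemma word_prod_rev:
  assumes "set ss \<subseteq> simple_refls n"
  shows "word_prod (rev ss) \<circ> word_prod ss = id"
  using assms
proof (induction ss)
  case (Cons s ss)
  then have "s \<circ> s = id" by (auto simp: simple_refls_def)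
  then have "word_prod (rev ss) \<circ> s \<circ> (s \<circ> word_prod ss) = word_prod (rev ss) \<circ> word_prod ss"
    by (metis comp_assoc comp_id)
  also have "\<dots> = id" using Cons.prems by (intro Cons.IH) simp
  also have "word_prod (rev ss) \<circ> s = word_prod (rev (s # ss))"
    by simp
  finally show ?case by simp
qed simp

text \<open>Reversing a reduced word gives a word of the same size for the inverse. This transfers
  facts on right multiplication to left multiplication.\<close>

lemma card_inversions_inv:
  assumes "w \<in> carrier W"
  shows "card (inversions (inv\<^bsub>W\<^esub> w)) = card (inversions w)"
proof -
  have le: "card (inversions (inv\<^bsub>W\<^esub> v)) \<le> card (inversions v)" if v: "v \<in> carrier W" for v
  proof -
    obtain ss where ss: "length ss = card (inversions v)" "set ss \<subseteq> simple_refls n" "word_prod ss = v"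
      using reduced_word[OF v] by blast
    have "inv\<^bsub>W\<^esub> v = word_prod (rev ss)"
      by (rule W.inv_equality) (use word_prod_rev[OF ss(2)] word_prod_carrier[of "rev ss"] ss v in auto)
    then show ?thesis using card_inversions_le_word[of "rev ss"] ss by simp
  qed
  show ?thesis using le[OF assms] le[of "inv\<^bsub>W\<^esub> w"] assms by simp
qed

section \<open>Ascents as Bruhat steps\<close>

lemma len_right_ascent:
  assumes "w \<in> carrier W" "w k < w (k + 1)"
  shows "len w < len (w \<circ> simple_refl n k)"
  using assms card_inversions_ascent[OF assms]
  by (simp add: word_length_eq comp_carrier simple_refl_carrier)

lemma len_left_ascent:
  assumes w: "w \<in> carrier W" and "(inv\<^bsub>W\<^esub> w) k < (inv\<^bsub>W\<^esub> w) (k + 1)"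
  shows "len w < len (simple_refl n k \<circ> w)"
proof -
  let ?s = "simple_refl n k"
  have s: "?s \<in> carrier W" by (rule simple_refl_carrier)
  have "inv\<^bsub>W\<^esub> (?s \<circ> w) = inv\<^bsub>W\<^esub> w \<circ> ?s"
    using W.inv_mult_group[OF s w] by (simp add: inv_simple_refl)
  then have "card (inversions (?s \<circ> w)) = card (inversions (inv\<^bsub>W\<^esub> w \<circ> ?s))"
    using card_inversions_inv[of "?s \<circ> w"] comp_carrier[OF s w] by simp
  also have "\<dots> = Suc (card (inversions w))"
    using card_inversions_ascent[of "inv\<^bsub>W\<^esub> w" k] assms card_inversions_inv[OF w] by simp
  finally show ?thesis using w s by (simp add: word_length_eq comp_carrier)
qed

lemma bruhat_step_right:
  assumes w: "w \<in> carrier W" and "w k < w (k + 1)"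
  shows "bruhat_step W (simple_refls n) w (w \<circ> simple_refl n k)"
proof -
  have "simple_refl n k \<in> reflections W (simple_refls n)"
    unfolding reflections_def simple_refls_def
    by (rule CollectI, rule exI[of _ id], rule exI[of _ "simple_refl n k"])
      (use W.one_closed W.inv_one in auto)
  then show ?thesis
    using assms len_right_ascent[OF assms]
    by (auto simp: bruhat_step_def comp_carrier simple_refl_carrier)
qed

text \<open>Bruhat steps multiply by a reflection on the right; left multiplication by
  \<open>s\<close> is right multiplication by the conjugate of \<open>s\<close> under the inverse of
  \<open>w\<close>.\<close>

lemma bruhat_step_left:
  assumes w: "w \<in> carrier W" and "(inv\<^bsub>W\<^esub> w) k < (inv\<^bsub>W\<^esub> w) (k + 1)"
  shows "bruhat_step W (simple_refls n) w (simple_refl n k \<circ> w)"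
proof -
  let ?s = "simple_refl n k"
  let ?t = "inv\<^bsub>W\<^esub> w \<circ> ?s \<circ> w"
  have "?t \<in> reflections W (simple_refls n)"
    unfolding reflections_def simple_refls_def
    by (rule CollectI, rule exI[of _ "inv\<^bsub>W\<^esub> w"], rule exI[of _ ?s]) (use w in auto)
  moreover have "?s \<circ> w = w \<circ> ?t"
    using W.r_inv[OF w] by (simp flip: comp_assoc)
  ultimately show ?thesis
    using assms len_left_ascent[OF assms]
    by (auto simp: bruhat_step_def comp_carrier simple_refl_carrier)
qed

subsection \<open>Parabolic subgroups and double cosets\<close>

text \<open>The number \<open>c\<close> of the interval from \<open>k + c * N + 1\<close> to
  \<open>k + c * N + N\<close> containing \<open>z\<close>. The boundaries between these intervals
  are the places where \<open>simple_refl n k\<close> acts.\<close>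

definition block :: "int \<Rightarrow> int \<Rightarrow> int" where
  "block k z = (z - k - 1) div N"

lemma block_eq_iff: "block k z = c \<longleftrightarrow> k + c * N < z \<and> z \<le> k + c * N + N"
proof
  have "0 \<le> (z - k - 1) mod N" "(z - k - 1) mod N < N" using N_pos by auto
  moreover have "(z - k - 1) div N * N + (z - k - 1) mod N = z - k - 1" by simp
  ultimately show "k + c * N < z \<and> z \<le> k + c * N + N" if "block k z = c"
    using that unfolding block_def by auto
  show "block k z = c" if "k + c * N < z \<and> z \<le> k + c * N + N"
    unfolding block_def
    by (rule int_div_pos_eq[where r = "z - k - 1 - c * N"]) (use that in \<open>auto simp: mult.commute\<close>)
qed

lemma block_bounds: "k + block k z * N < z \<and> z \<le> k + block k z * N + N"
  using block_eq_iff[of k z "block k z"] by auto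

lemma block_0_window: "block 0 z = 0 \<longleftrightarrow> z \<in> {1..N}"
  by (auto simp: block_eq_iff)

lemma not_cong_between: "k < i \<Longrightarrow> i < k + N \<Longrightarrow> \<not> [i = k] (mod N)"
proof
  assume "k < i" "i < k + N" "[i = k] (mod N)"
  moreover from this obtain q where q: "i = k + q * N" by (auto simp: cong_iff_mult)
  ultimately have "0 * N < q * N" "q * N < 1 * N" by linarith+
  then have "0 < q" "q < 1" using N_pos by (meson mult_right_less_imp_less order_less_imp_le)+
  then show False by simp
qed

lemma simple_refl_in_hat:
  assumes "\<not> [i = k] (mod N)"
  shows "simple_refl n i \<in> hat n k"
proof -
  have "simple_refl n i i = i + 1" using simple_refl_eqs(1)[of i 0] by simp
  moreover have "simple_refl n k i \<noteq> i + 1" using assms by (simp add: simple_refl_def)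
  ultimately show ?thesis by (auto simp: hat_def simple_refls_def)
qed

lemma hatE:
  assumes "s \<in> hat n k"
  obtains i where "s = simple_refl n i" "\<not> [i = k] (mod N)"
proof -
  obtain i where i: "s = simple_refl n i" "simple_refl n i \<noteq> simple_refl n k"
    using assms by (auto simp: hat_def simple_refls_def)
  have "\<not> [i = k] (mod N)"
  proof
    assume "[i = k] (mod N)"
    moreover from this have "[i + 1 = k + 1] (mod N)" by (simp add: cong_add)
    ultimately have "[j = i] (mod N) \<longleftrightarrow> [j = k] (mod N)"
      "[j = i + 1] (mod N) \<longleftrightarrow> [j = k + 1] (mod N)" for j
      by (meson cong_sym cong_trans)+
    then have "simple_refl n i = simple_refl n k" by (auto simp: simple_refl_def)
    with i(2) show False ..
  qed
  with i(1) show ?thesis by (rule that)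
qed

text \<open>Leaving a block means exchanging some \<open>k + c * N\<close> with its successor, which
  only the reflection of the class of \<open>k\<close> does.\<close>

lemma block_simple_refl:
  assumes "\<not> [i = k] (mod N)"
  shows "block k (simple_refl n i z) = block k z"
proof -
  have "block k (z + 1) = block k z" if "[z = i] (mod N)"
  proof -
    have "z \<noteq> k + (block k z + 1) * N"
      using assms that by (metis cong_iff_mult cong_sym cong_trans)
    then show ?thesis using block_bounds[of k z] by (auto simp: block_eq_iff algebra_simps)
  qed
  moreover have "block k (z - 1) = block k z" if "[z = i + 1] (mod N)"
  proof -
    have "[z - 1 = i] (mod N)" using cong_diff[OF that, of 1 1] by simp
    then have "z - 1 \<noteq> k + block k z * N"
      using assms by (metis cong_iff_mult cong_sym cong_trans)
    then show ?thesis using block_bounds[of k z] by (auto simp: block_eq_iff)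
  qed
  ultimately show ?thesis by (simp add: simple_refl_def)
qed

lemma hat_carrier: "hat n k \<subseteq> carrier W"
  using simple_refls_carrier by (auto simp: hat_def)

lemma parabolic_subgroup: "subgroup (parabolic n k) W"
  unfolding parabolic_def by (rule W.generate_is_subgroup[OF hat_carrier])

lemma parabolic_carrier: "h \<in> parabolic n k \<Longrightarrow> h \<in> carrier W"
  using subgroup.subset[OF parabolic_subgroup] by blast

lemma simple_refl_parabolic: "\<not> [i = k] (mod N) \<Longrightarrow> simple_refl n i \<in> parabolic n k"
  unfolding parabolic_def by (intro generate.incl simple_refl_in_hat)

lemma block_parabolic:
  assumes "h \<in> parabolic n k"
  shows "block k (h z) = block k z"
  using assms unfolding parabolic_def
proof (induction h arbitrary: z rule: generate.induct)
  case (incl h)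
  then show ?case by (metis hatE block_simple_refl)
next
  case (inv h)
  then show ?case by (metis hatE block_simple_refl inv_simple_refl)
qed simp_all

text \<open>Both numbers lie in one block of \<open>N\<close> elements. This later bounds the
  lengths within a double coset.\<close>

lemma displacement_parabolic:
  assumes "h \<in> parabolic n k"
  shows "\<bar>h z - z\<bar> \<le> N"
  using block_bounds[of k "h z"] block_bounds[of k z] block_parabolic[OF assms, of z] by auto

lemma bij_window_parabolic:
  assumes "h \<in> parabolic n 0"
  shows "bij_betw h {1..N} {1..N}"
proof -
  have "h ` {1..N} \<subseteq> {1..N}"
    by (rule image_subsetI) (use block_parabolic[OF assms] block_0_window in metis)
  moreover have "inj_on h {1..N}"
    using carrierD(1)[OF parabolic_carrier[OF assms]] by (auto simp: bij_def intro: inj_on_subset)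
  ultimately show ?thesis by (simp add: bij_betw_def endo_inj_surj)
qed

definition dcoset :: "int \<Rightarrow> (int \<Rightarrow> int) \<Rightarrow> (int \<Rightarrow> int) set" where
  "dcoset k x = (parabolic n k #>\<^bsub>W\<^esub> x) <#>\<^bsub>W\<^esub> parabolic n 0"

lemma weyl_double_cosets_eq: "weyl_double_cosets n k = dcoset k ` carrier W"
  by (auto simp: weyl_double_cosets_def double_cosets_def dcoset_def)

lemma dcoset_iff: "y \<in> dcoset k x \<longleftrightarrow> (\<exists>h\<in>parabolic n k. \<exists>g\<in>parabolic n 0. y = h \<circ> x \<circ> g)"
  by (auto simp: dcoset_def set_mult_def r_coset_def)

lemma dcoset_carrier: "x \<in> carrier W \<Longrightarrow> y \<in> dcoset k x \<Longrightarrow> y \<in> carrier W"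
  by (auto simp: dcoset_iff comp_carrier parabolic_carrier)

lemma id_parabolic: "id \<in> parabolic n k"
  using subgroup.one_closed[OF parabolic_subgroup] by simp

lemma comp_parabolic: "g \<in> parabolic n k \<Longrightarrow> h \<in> parabolic n k \<Longrightarrow> g \<circ> h \<in> parabolic n k"
  using subgroup.m_closed[OF parabolic_subgroup] by simp

lemma self_dcoset: "x \<in> dcoset k x"
  unfolding dcoset_iff by (rule bexI[OF _ id_parabolic], rule bexI[OF _ id_parabolic]) simp

lemma dcoset_left: "y \<in> dcoset k x \<Longrightarrow> h \<in> parabolic n k \<Longrightarrow> h \<circ> y \<in> dcoset k x"
  unfolding dcoset_iff by (metis comp_assoc comp_parabolic)

lemma dcoset_right: "y \<in> dcoset k x \<Longrightarrow> g \<in> parabolic n 0 \<Longrightarrow> y \<circ> g \<in> dcoset k x"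
  unfolding dcoset_iff by (metis comp_assoc comp_parabolic)

lemma dcoset_subset: "y \<in> dcoset k x \<Longrightarrow> dcoset k y \<subseteq> dcoset k x"
  using dcoset_left dcoset_right by (auto simp: dcoset_iff[of _ k y])

lemma dcoset_eq:
  assumes x: "x \<in> carrier W" and y: "y \<in> dcoset k x"
  shows "dcoset k y = dcoset k x"
proof -
  obtain h g where hg: "h \<in> parabolic n k" "g \<in> parabolic n 0" and "y = h \<circ> x \<circ> g"
    using y by (auto simp: dcoset_iff)
  then have "inv\<^bsub>W\<^esub> h \<circ> y \<circ> inv\<^bsub>W\<^esub> g = (inv\<^bsub>W\<^esub> h \<circ> h) \<circ> x \<circ> (g \<circ> inv\<^bsub>W\<^esub> g)"
    by (simp add: comp_assoc)
  then have "x = inv\<^bsub>W\<^esub> h \<circ> y \<circ> inv\<^bsub>W\<^esub> g"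
    using W.l_inv[OF parabolic_carrier[OF hg(1)]] W.r_inv[OF parabolic_carrier[OF hg(2)]] by simp
  then have "x \<in> dcoset k y"
    using hg subgroup.m_inv_closed[OF parabolic_subgroup] by (auto simp: dcoset_iff)
  then show ?thesis using y dcoset_subset by blast
qed

text \<open>Lets the longest element of the finite parabolic be found by the same argument as the
  maxima of double cosets.\<close>

lemma parabolic_0_dcoset: "parabolic n 0 = dcoset 0 id"
proof
  show "parabolic n 0 \<subseteq> dcoset 0 id" using dcoset_left[OF self_dcoset, of _ 0 id] by auto
  show "dcoset 0 id \<subseteq> parabolic n 0" using comp_parabolic by (auto simp: dcoset_iff)
qed

subsection \<open>The Bruhat maximum of a double coset\<close>

text \<open>Right descents at all generators of \<open>parabolic n 0\<close> and left descents at
  all generators of \<open>parabolic n k\<close>. The two ranges meet each residue class other than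
  that of 0, respectively \<open>k\<close>, exactly once.\<close>

definition extremal :: "int \<Rightarrow> (int \<Rightarrow> int) \<Rightarrow> bool" where
  "extremal k x \<longleftrightarrow> (\<forall>i. 1 \<le> i \<and> i < N \<longrightarrow> x (i + 1) < x i) \<and>
     (\<forall>i. k + 1 \<le> i \<and> i < k + N \<longrightarrow> (inv\<^bsub>W\<^esub> x) (i + 1) < (inv\<^bsub>W\<^esub> x) i)"

text \<open>An integer sequence that decreases strictly drops by at least 1 per step; this sharp
  form is what allows squeezing in \<open>extremal_form\<close>.\<close>

lemma strict_steps:
  fixes f :: "int \<Rightarrow> int"
  assumes step: "\<And>i. a \<le> i \<Longrightarrow> i < b \<Longrightarrow> f (i + 1) < f i" and "a \<le> i" "i \<le> j" "j \<le> b"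
  shows "f j + j \<le> f i + i"
  using assms(3,4)
proof (induction j rule: int_ge_induct)
  case (step j)
  then show ?case using assms(1)[of j] assms(2) by simp
qed simp

lemma inv_apply: "x \<in> carrier W \<Longrightarrow> (inv\<^bsub>W\<^esub> x) (x i) = i"
  by (simp add: inv_W bij_is_inj carrierD)

lemma extremal_antitone:
  assumes "extremal k x" "1 \<le> i" "i < j" "j \<le> N"
  shows "x j < x i"
  using strict_steps[of 1 N x i j] assms by (auto simp: extremal_def)

text \<open>The offsets \<open>r i\<close> of the values within their blocks decrease strictly along
  the window. As they lie in \<open>{1..N}\<close>, they must be \<open>N, ..., 1\<close>.\<close>

lemma extremal_form:
  assumes x: "x \<in> carrier W" and ext: "extremal k x" and i: "i \<in> {1..N}"
  shows "x i = k + N + 1 - i + block k (x i) * N"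
proof -
  define r where "r i = x i - k - block k (x i) * N" for i
  have r_in: "r i \<in> {1..N}" for i
    using block_bounds[of k "x i"] by (auto simp: r_def)
  let ?y = "inv\<^bsub>W\<^esub> x"
  have y: "?y (k + r i) = i - block k (x i) * N" for i
    using carrierD(3)[of ?y "x i" "- block k (x i)"] x by (simp add: r_def inv_apply)
  have strict: "r j < r i" if ij: "1 \<le> i" "i < j" "j \<le> N" for i j
  proof (rule ccontr)
    assume "\<not> r j < r i"
    then consider "r i = r j" | "r i < r j" by linarith
    then show False
    proof cases
      case 1
      \<comment> \<open>Equal offsets make the positions congruent modulo \<open>N\<close>, hence
        equal within the window.\<close>
      then have "i = j + (block k (x i) - block k (x j)) * N"
        using y[of i] y[of j] by (simp add: algebra_simps)
      moreover from this have "block k (x i) - block k (x j) = 0"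
        using ij by (intro window_unique[of i j]) auto
      ultimately show False using ij by simp
    next
      case 2
      \<comment> \<open>The left descents bound \<open>j + r j\<close> minus the block term of
        \<open>j\<close>, while \<open>x j < x i\<close> bounds \<open>r j\<close> plus that term.
        Adding cancels the blocks and leaves \<open>j + 2 * r j < i + 2 * r i\<close>.\<close>
      have "?y (k + r j) + (k + r j) \<le> ?y (k + r i) + (k + r i)"
        by (rule strict_steps[of "k + 1" "k + N"])
          (use ext 2 r_in[of i] r_in[of j] in \<open>auto simp: extremal_def\<close>)
      moreover have "x j < x i" using extremal_antitone[OF ext ij] .
      ultimately show False using 2 ij y[of i] y[of j] unfolding r_def by linarith
    qed
  qed
  \<comment> \<open>With \<open>1 \<le> r N\<close> and \<open>r 1 \<le> N\<close>, both ends equal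
    \<open>N + 1\<close>.\<close>
  have "r N + N \<le> r i + i" "r i + i \<le> r 1 + 1"
    using i strict by (intro strict_steps[of 1 N]; auto)+
  then show ?thesis using r_in[of 1] r_in[of N] unfolding r_def by auto
qed

text \<open>In \<open>x j < x i\<close> the offsets differ by \<open>j - i < N\<close>, too little
  to outweigh a larger block number at \<open>j\<close>.\<close>

lemma extremal_block_antitone:
  assumes x: "x \<in> carrier W" and ext: "extremal k x" and ij: "1 \<le> i" "i \<le> j" "j \<le> N"
  shows "block k (x j) \<le> block k (x i)"
proof (cases "i = j")
  case False
  then have "x j < x i" using ij by (intro extremal_antitone[OF ext]) auto
  moreover have "i \<in> {1..N}" "j \<in> {1..N}" using ij by auto
  note this[THEN extremal_form[OF x ext]]
  moreover have "(block k (x i) + 1) * N = block k (x i) * N + N" by (simp add: algebra_simps)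
  ultimately have "block k (x j) * N < (block k (x i) + 1) * N" using ij by linarith
  then show ?thesis using N_pos mult_right_less_imp_less by fastforce
qed simp

text \<open>Two sorted lists with the same multiset of entries coincide. Entries are negated because
  \<open>sorted\<close> means ascending.\<close>

lemma antitone_rearrangement_unique:
  fixes u v :: "int \<Rightarrow> int"
  assumes u: "\<And>i j. 1 \<le> i \<Longrightarrow> i \<le> j \<Longrightarrow> j \<le> N \<Longrightarrow> u j \<le> u i"
    and v: "\<And>i j. 1 \<le> i \<Longrightarrow> i \<le> j \<Longrightarrow> j \<le> N \<Longrightarrow> v j \<le> v i"
    and g: "bij_betw g {1..N} {1..N}" "\<And>i. i \<in> {1..N} \<Longrightarrow> v i = u (g i)"
    and i: "i \<in> {1..N}"
  shows "u i = v i"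
proof -
  let ?L = "\<lambda>f. map (\<lambda>i. - f i) [1..N]"
  have sorted: "sorted (?L f)" if "\<And>i j. 1 \<le> i \<Longrightarrow> i \<le> j \<Longrightarrow> j \<le> N \<Longrightarrow> f j \<le> f i"
    for f :: "int \<Rightarrow> int"
    using that by (auto simp: sorted_iff_nth_mono nth_upto)
  have mset: "mset (?L f) = image_mset (\<lambda>i. - f i) (mset_set {1..N})" for f :: "int \<Rightarrow> int"
    using mset_set_set[of "[1..N]"] by simp
  have "image_mset (\<lambda>i. - v i) (mset_set {1..N}) = image_mset (\<lambda>i. - u (g i)) (mset_set {1..N})"
    by (rule image_mset_cong) (use g(2) in auto)
  also have "\<dots> = image_mset (\<lambda>i. - u i) (image_mset g (mset_set {1..N}))"
    by (simp add: multiset.map_comp comp_def)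
  also have "image_mset g (mset_set {1..N}) = mset_set {1..N}"
    using g(1) by (simp add: image_mset_mset_set bij_betw_def)
  finally have "mset (?L v) = mset (?L u)" by (simp only: mset)
  from properties_for_sort[OF this sorted[OF v]] properties_for_sort[OF refl sorted[OF u]]
  have "?L u = ?L v" by (simp only:)
  then show ?thesis using i by auto
qed

text \<open>The left factor \<open>h\<close> preserves blocks and the right factor \<open>g\<close>
  permutes the window, so the two antitone block sequences are rearrangements of each other. They
  agree, and \<open>extremal_form\<close> recovers the values.\<close>

lemma extremal_unique:
  assumes x0: "x0 \<in> carrier W" and x: "x \<in> dcoset k x0" "extremal k x"
    and y: "y \<in> dcoset k x0" "extremal k y"
  shows "x = y"
proof (rule carrier_ext)
  show xc: "x \<in> carrier W" and yc: "y \<in> carrier W" using x y x0 dcoset_carrier by blast+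
  have "y \<in> dcoset k x" using dcoset_eq[OF x0 x(1)] y(1) by simp
  then obtain h g where hg: "h \<in> parabolic n k" "g \<in> parabolic n 0" "y = h \<circ> x \<circ> g"
    by (auto simp: dcoset_iff)
  fix i assume i: "i \<in> {1..N}"
  have "block k (x i) = block k (y i)"
  proof (rule antitone_rearrangement_unique[where g = g and
        u = "\<lambda>i. block k (x i)" and v = "\<lambda>i. block k (y i)"])
    show "bij_betw g {1..N} {1..N}" by (rule bij_window_parabolic[OF hg(2)])
    show "block k (y i) = block k (x (g i))" for i
      by (simp add: hg(3) block_parabolic[OF hg(1)])
  qed (use extremal_block_antitone xc yc x y i in auto)
  then show "x i = y i"
    using extremal_form[OF xc x(2) i] extremal_form[OF yc y(2) i] by metis
qed

text \<open>A missing descent is an ascent, since consecutive values differ; multiplying by that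
  generator goes up and stays in the double coset.\<close>

lemma not_extremal_step:
  assumes x0: "x0 \<in> carrier W" and x: "x \<in> dcoset k x0" "\<not> extremal k x"
  shows "\<exists>y\<in>dcoset k x0. bruhat_step W (simple_refls n) x y"
proof -
  have xc: "x \<in> carrier W" using x x0 dcoset_carrier by blast
  consider i where "1 \<le> i" "i < N" "\<not> x (i + 1) < x i"
    | i where "k + 1 \<le> i" "i < k + N" "\<not> (inv\<^bsub>W\<^esub> x) (i + 1) < (inv\<^bsub>W\<^esub> x) i"
    using x(2) by (auto simp: extremal_def)
  then show ?thesis
  proof cases
    case 1
    then have "x i < x (i + 1)" using neq_succ[OF xc, of i] by simp
    moreover have "simple_refl n i \<in> parabolic n 0"
      using 1 by (intro simple_refl_parabolic not_cong_between) auto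
    ultimately show ?thesis using bruhat_step_right[OF xc] dcoset_right[OF x(1)] by blast
  next
    case 2
    then have "(inv\<^bsub>W\<^esub> x) i < (inv\<^bsub>W\<^esub> x) (i + 1)"
      using neq_succ[of "inv\<^bsub>W\<^esub> x" i] xc by simp
    moreover have "simple_refl n i \<in> parabolic n k"
      using 2 by (intro simple_refl_parabolic not_cong_between) auto
    ultimately show ?thesis using bruhat_step_left[OF xc] dcoset_left[OF x(1)] by blast
  qed
qed

text \<open>Each parabolic factor adds at most \<open>N\<close> to the displacement, so all
  inversion sets lie in one finite box. This ends the climb in
  \<open>ex_extremal_above\<close>.\<close>

lemma len_bounded_dcoset:
  assumes x0: "x0 \<in> carrier W"
  obtains B where "\<And>x. x \<in> dcoset k x0 \<Longrightarrow> len x \<le> B"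
proof -
  obtain M where M: "\<And>i. \<bar>x0 i - i\<bar> \<le> M" using displacement_bounded[OF x0] by blast
  let ?A = "{1..N} \<times> {1..N + 2 * (M + 2 * N)}"
  have "len x \<le> card ?A" if x: "x \<in> dcoset k x0" for x
  proof -
    obtain h g where hg: "h \<in> parabolic n k" "g \<in> parabolic n 0" "x = h \<circ> x0 \<circ> g"
      using x by (auto simp: dcoset_iff)
    have "\<bar>x i - i\<bar> \<le> M + 2 * N" for i
      using displacement_parabolic[OF hg(1), of "x0 (g i)"] displacement_parabolic[OF hg(2), of i]
        M[of "g i"] hg(3) by simp
    then have "card (inversions x) \<le> card ?A"
      by (intro card_mono inversions_bounded) simp_all
    then show ?thesis using word_length_eq dcoset_carrier[OF x0 x] by simp
  qed
  then show ?thesis by (rule that)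
qed

lemma ex_extremal_above:
  assumes x0: "x0 \<in> carrier W" and x: "x \<in> dcoset k x0"
  shows "\<exists>e\<in>dcoset k x0. extremal k e \<and> bruhat_le W (simple_refls n) x e"
proof -
  obtain B where B: "\<And>x. x \<in> dcoset k x0 \<Longrightarrow> len x \<le> B" using len_bounded_dcoset[OF x0] by blast
  show ?thesis
    using x
  proof (induction "B - len x" arbitrary: x rule: less_induct)
    case less
    show ?case
    proof (cases "extremal k x")
      case True
      then show ?thesis using less.prems by (auto simp: bruhat_le_def)
    next
      case False
      then obtain y where y: "y \<in> dcoset k x0" "bruhat_step W (simple_refls n) x y"
        using not_extremal_step[OF x0 less.prems] by blast
      then have "B - len y < B - len x"
        using B[OF y(1)] by (auto simp: bruhat_step_def)
      from less.hyps[OF this y(1)] obtain e where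
        "e \<in> dcoset k x0" "extremal k e" "bruhat_le W (simple_refls n) y e" by blast
      then show ?thesis
        using y(2) unfolding bruhat_le_def by (meson converse_rtranclp_into_rtranclp)
    qed
  qed
qed

lemma bruhat_le_len: "bruhat_le W (simple_refls n) x y \<Longrightarrow> x = y \<or> len x < len y"
  unfolding bruhat_le_def
proof (induction rule: rtranclp_induct)
  case (step y z)
  then show ?case by (auto simp: bruhat_step_def)
qed simp

text \<open>Every climb ends at the only extremal element, which is thus greatest and not merely
  maximal. This settles both uniqueness and existence in the definite descriptions below.\<close>

lemma bruhat_le_of_extremal:
  assumes x0: "x0 \<in> carrier W" and e: "e \<in> dcoset k x0" "extremal k e" and x: "x \<in> dcoset k x0"
  shows "bruhat_le W (simple_refls n) x e"
  using ex_extremal_above[OF x0 x] extremal_unique[OF x0 e] by blast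

lemma max_elt_eq:
  assumes x0: "x0 \<in> carrier W" and e: "e \<in> dcoset k x0" "extremal k e"
  shows "max_elt n (dcoset k x0) = e"
  unfolding max_elt_def bruhat_maximal_def
proof (rule the_equality)
  note le = bruhat_le_of_extremal[OF x0 e]
  show "e \<in> dcoset k x0 \<and> (\<forall>x\<in>dcoset k x0. bruhat_le W (simple_refls n) e x \<longrightarrow> x = e)"
  proof (intro conjI ballI impI e(1))
    fix x assume x: "x \<in> dcoset k x0" "bruhat_le W (simple_refls n) e x"
    \<comment> \<open>If they differed, each would be strictly longer than the other.\<close>
    show "x = e" using bruhat_le_len[OF le[OF x(1)]] bruhat_le_len[OF x(2)] by auto
  qed
  show "w = e" if "w \<in> dcoset k x0 \<and>
      (\<forall>x\<in>dcoset k x0. bruhat_le W (simple_refls n) w x \<longrightarrow> x = w)" for w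
    using that e(1) le[of w] by blast
qed

section \<open>The longest element of the finite parabolic\<close>

lemma longest_element_eq:
  assumes x0: "x0 \<in> carrier W" and e: "e \<in> dcoset k x0" "extremal k e"
  shows "longest_element W (simple_refls n) (dcoset k x0) = e"
  unfolding longest_element_def
proof (rule the_equality)
  note le = bruhat_le_of_extremal[OF x0 e]
  show "e \<in> dcoset k x0 \<and> (\<forall>x\<in>dcoset k x0. len x \<le> len e)"
    using e(1) bruhat_le_len[OF le] by (auto intro: less_imp_le)
  show "w = e" if "w \<in> dcoset k x0 \<and> (\<forall>x\<in>dcoset k x0. len x \<le> len w)" for w
    using that e(1) bruhat_le_len[OF le, of w] by auto
qed

lemma w_hat_parabolic: "w_hat n 0 \<in> parabolic n 0"
  and w_hat_apply: "i \<in> {1..N} \<Longrightarrow> w_hat n 0 i = N + 1 - i"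
proof -
  note id = id_carrier
  obtain e where e: "e \<in> dcoset 0 id" "extremal 0 e"
    using ex_extremal_above[OF id self_dcoset] by blast
  have w: "w_hat n 0 = e"
    unfolding w_hat_def parabolic_0_dcoset by (rule longest_element_eq[OF id e])
  then show p: "w_hat n 0 \<in> parabolic n 0" using e(1) parabolic_0_dcoset by simp
  show "w_hat n 0 i = N + 1 - i" if i: "i \<in> {1..N}"
  proof -
    \<comment> \<open>Elements of this parabolic preserve the window, so all block numbers vanish
      and the extremal form reduces to the reversal.\<close>
    have "block 0 (e i) = 0" using block_parabolic[OF p, of i] i w by (simp add: block_0_window)
    with extremal_form[OF dcoset_carrier[OF id e(1)] e(2) i] have "e i = 0 + N + 1 - i + 0 * N"
      by argo
    then show ?thesis using w by simp
  qed
qed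

lemma w_hat_invol: "w_hat n 0 \<circ> w_hat n 0 = id"
proof (rule carrier_ext)
  show "w_hat n 0 \<circ> w_hat n 0 \<in> carrier W"
    by (intro comp_carrier parabolic_carrier[OF w_hat_parabolic])
  show "id \<in> carrier W" by (rule id_carrier)
  show "(w_hat n 0 \<circ> w_hat n 0) i = id i" if i: "i \<in> {1..N}" for i
  proof -
    have "N + 1 - i \<in> {1..N}" using i by auto
    from w_hat_apply[OF this] show ?thesis by (simp add: w_hat_apply[OF i])
  qed
qed

section \<open>Representatives of double cosets and their coefficients\<close>

lemma coset_elt_comp: "coset_elt n p = max_elt n p \<circ> w_hat n 0"
  by (simp add: coset_elt_def)

lemma coset_elt_form:
  assumes p: "p \<in> weyl_double_cosets n k"
  obtains c where "coset_elt n p \<in> carrier W" "p = dcoset k (coset_elt n p)"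
    "\<And>i. i \<in> {1..N} \<Longrightarrow> coset_elt n p i = k + i + c i * N"
proof -
  obtain x0 where x0: "x0 \<in> carrier W" "p = dcoset k x0"
    using p by (auto simp: weyl_double_cosets_eq)
  obtain e where e: "e \<in> dcoset k x0" "extremal k e"
    using ex_extremal_above[OF x0(1) self_dcoset] by blast
  have ec: "e \<in> carrier W" using dcoset_carrier[OF x0(1) e(1)] .
  have eq: "coset_elt n p = e \<circ> w_hat n 0"
    using max_elt_eq[OF x0(1) e] x0(2) by (simp add: coset_elt_comp)
  have in_p: "coset_elt n p \<in> dcoset k x0"
    unfolding eq using e(1) w_hat_parabolic by (rule dcoset_right)
  show ?thesis
  \<comment> \<open>The coefficients are the block numbers of the maximum read backwards, as
    \<open>w_hat n 0\<close> reverses the window.\<close>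
  proof (rule that[of "\<lambda>i. block k (e (N + 1 - i))"])
    show "coset_elt n p \<in> carrier W" using dcoset_carrier[OF x0(1) in_p] .
    show "p = dcoset k (coset_elt n p)" using dcoset_eq[OF x0(1) in_p] x0(2) by simp
    show "coset_elt n p i = k + i + block k (e (N + 1 - i)) * N" if "i \<in> {1..N}" for i
    proof -
      have "coset_elt n p i = e (N + 1 - i)" using eq w_hat_apply[OF that] by simp
      moreover have "N + 1 - i \<in> {1..N}" using that by auto
      note extremal_form[OF ec e(2) this]
      ultimately show ?thesis by linarith
    qed
  qed
qed

text \<open>Reversing the window makes \<open>w\<close> extremal, so
  \<open>w \<circ> w_hat n 0\<close> is the maximum; a second reversal returns
  \<open>w\<close>.\<close>

lemma coset_elt_dcoset:
  assumes w: "w \<in> carrier W" and form: "\<And>i. i \<in> {1..N} \<Longrightarrow> w i = k + i + c i * N"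
    and mono: "\<And>i. 1 \<le> i \<Longrightarrow> i < N \<Longrightarrow> c i \<le> c (i + 1)"
  shows "coset_elt n (dcoset k w) = w"
proof -
  let ?v = "w_hat n 0"
  have v: "?v \<in> carrier W" using w_hat_parabolic parabolic_carrier by blast
  have inv_v: "inv\<^bsub>W\<^esub> ?v = ?v"
    by (rule W.inv_equality) (use v w_hat_invol in auto)
  have mono': "c i * N \<le> c (i + 1) * N" if "1 \<le> i" "i < N" for i
    using mono[OF that] by (simp add: mult_right_mono)
  \<comment> \<open>Here \<open>k + r\<close> is the translate of \<open>w r\<close> by
    \<open>- c r * N\<close>, so the inverse of \<open>w\<close> is known there.\<close>
  have inv_eq: "(inv\<^bsub>W\<^esub> (w \<circ> ?v)) (k + r) = N + 1 - r - c r * N" if r: "r \<in> {1..N}" for r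
  proof -
    have "(inv\<^bsub>W\<^esub> (w \<circ> ?v)) (k + r) = ?v ((inv\<^bsub>W\<^esub> w) (w r + (- c r) * N))"
      using W.inv_mult_group[OF w v] inv_v form[OF r] by simp
    also have "\<dots> = ?v (r + (- c r) * N)"
      using carrierD(3)[of "inv\<^bsub>W\<^esub> w" "w r" "- c r"] w by (simp add: inv_apply)
    finally show ?thesis using carrierD(3)[OF v, of r "- c r"] w_hat_apply[OF r] by simp
  qed
  have "extremal k (w \<circ> ?v)"
    unfolding extremal_def
  proof (intro conjI allI impI)
    fix i assume i: "1 \<le> i \<and> i < N"
    then have "(w \<circ> ?v) (i + 1) = k + (N - i) + c (N - i) * N"
      "(w \<circ> ?v) i = k + (N + 1 - i) + c (N + 1 - i) * N"
      using form[of "N - i"] form[of "N + 1 - i"] by (simp_all add: w_hat_apply)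
    moreover have "c (N - i) * N \<le> c (N - i + 1) * N" using i by (intro mono') auto
    then have "c (N - i) * N \<le> c (N + 1 - i) * N" by (simp only: diff_add_eq)
    ultimately show "(w \<circ> ?v) (i + 1) < (w \<circ> ?v) i" by linarith
  next
    fix i assume i: "k + 1 \<le> i \<and> i < k + N"
    then have "(inv\<^bsub>W\<^esub> (w \<circ> ?v)) i = N + 1 - (i - k) - c (i - k) * N"
      "(inv\<^bsub>W\<^esub> (w \<circ> ?v)) (i + 1) = N + 1 - (i - k + 1) - c (i - k + 1) * N"
      using inv_eq[of "i - k"] inv_eq[of "i - k + 1"] by (simp_all add: add.assoc[symmetric])
    with i mono'[of "i - k"] show "(inv\<^bsub>W\<^esub> (w \<circ> ?v)) (i + 1) < (inv\<^bsub>W\<^esub> (w \<circ> ?v)) i"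
      by linarith
  qed
  then have "max_elt n (dcoset k w) = w \<circ> ?v"
    by (intro max_elt_eq[OF w] dcoset_right[OF self_dcoset] w_hat_parabolic)
  then show ?thesis by (simp add: coset_elt_comp comp_assoc w_hat_invol)
qed

lemma sum_window_nat: "(\<Sum>i = 1..N. f i) = (\<Sum>i = 1..n. f (int i))"
  by (rule sum.reindex_bij_witness[of _ int nat]) auto

text \<open>The prescribed values meet every residue class once, so the periodic extension is
  bijective; the condition on the sum of the \<open>c i\<close> is exactly the
  normalisation.\<close>

lemma carrier_of_coeffs:
  assumes sum: "(\<Sum>i = 1..N. c i) = - k"
  obtains w where "w \<in> carrier W" "\<And>i. i \<in> {1..N} \<Longrightarrow> w i = k + i + c i * N"
proof -
  define q where "q z = (z - 1) div N" for z
  define w where "w z = k + (z - q z * N) + c (z - q z * N) * N + q z * N" for z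
  have q_in: "z - q z * N \<in> {1..N}" for z
    unfolding q_def by (rule window_div)
  have q_eq: "q (i + m * N) = m" if "i \<in> {1..N}" for i m
  proof -
    have "m - q (i + m * N) = 0"
      by (rule window_unique[OF q_in[of "i + m * N"] that]) (simp add: algebra_simps)
    then show ?thesis by simp
  qed
  have w_eq: "w (i + m * N) = k + i + c i * N + m * N" if "i \<in> {1..N}" for i m
    using q_eq[OF that] by (simp add: w_def)
  have dec: "\<exists>i m. i \<in> {1..N} \<and> z = i + m * N" for z
    using q_in[of z] by (intro exI[of _ "z - q z * N"] exI[of _ "q z"]) simp
  have form: "w i = k + i + c i * N" if "i \<in> {1..N}" for i
    using w_eq[OF that, of 0] by simp
  have "w \<in> carrier W"
  proof (rule carrierI)
    show "bij w"
    proof (rule bijI)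
      show "inj w"
      proof (rule injI)
        fix x y assume eq: "w x = w y"
        obtain i m where x: "i \<in> {1..N}" "x = i + m * N" using dec by blast
        obtain j l where y: "j \<in> {1..N}" "y = j + l * N" using dec by blast
        have i: "i = j + (c j + l - c i - m) * N"
          using eq x y w_eq[of i m] w_eq[of j l] by (simp add: algebra_simps)
        have "c j + l - c i - m = 0" by (rule window_unique[OF x(1) y(1) i])
        then show "x = y" using i x y by auto
      qed
      show "surj w"
      proof (rule surjI)
        fix y
        \<comment> \<open>The preimage is the window representative \<open>i\<close> of
          \<open>y - k\<close>, translated so as to compensate for \<open>c i\<close>.\<close>
        show "w (y - k - q (y - k) * N + (q (y - k) - c (y - k - q (y - k) * N)) * N) = y"
          by (subst w_eq[OF q_in]) (simp add: algebra_simps)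
      qed
    qed
    show "w (z + N) = w z + N" for z
    proof -
      obtain i m where z: "i \<in> {1..N}" "z = i + m * N" using dec by blast
      then have "z + N = i + (m + 1) * N" by (simp add: algebra_simps)
      then show ?thesis using w_eq[OF z(1), of "m + 1"] w_eq[OF z(1), of m] z(2)
        by (simp add: algebra_simps)
    qed
    have "(\<Sum>i = 1..N. w i - i) = (\<Sum>i = 1..N. k + c i * N)"
      by (rule sum.cong) (use form in auto)
    also have "\<dots> = N * k + (\<Sum>i = 1..N. c i) * N"
      by (simp add: sum.distrib sum_distrib_right)
    finally show "(\<Sum>i = 1..N. w i - i) = 0" by (simp add: sum)
  qed
  then show ?thesis using form by (rule that)
qed

subsection \<open>Weights\<close>

text \<open>Pairing with the simple coroots, which are dual to the fundamental weights: the common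
  term \<open>j / n\<close> cancels and only \<open>j = i\<close> jumps.\<close>

lemma weight_comb_diff:
  assumes i: "i \<in> {1..<n}"
  shows "weight_comb n g i - weight_comb n g (i + 1) = of_int (g i)"
proof -
  have "weight_comb n g i - weight_comb n g (i + 1)
      = (\<Sum>j = 1..<n. of_int (g j) * (fund_weight n j i - fund_weight n j (i + 1)))"
    by (simp add: weight_comb_def sum_subtractf right_diff_distrib)
  also have "\<dots> = (\<Sum>j = 1..<n. if j = i then of_int (g j) else 0)"
    by (rule sum.cong) (use i in \<open>auto simp: fund_weight_def\<close>)
  also have "\<dots> = of_int (g i)" using i by simp
  finally show ?thesis .
qed

lemma weight_comb_inj:
  assumes "weight_comb n g = weight_comb n h" "i \<in> {1..<n}"
  shows "g i = h i"
  using weight_comb_diff[OF assms(2), of g] weight_comb_diff[OF assms(2), of h] assms(1) by simp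

lemma weight_comb_cong:
  "(\<And>i. i \<in> {1..<n} \<Longrightarrow> g i = h i) \<Longrightarrow> weight_comb n g = weight_comb n h"
  by (simp add: weight_comb_def)

text \<open>By \<open>weight_comb_inj\<close> the weight determines all coefficients that enter the
  sum.\<close>

lemma sh_weight_comb:
  "sh n (weight_comb n (\<lambda>j. int (g j))) = (\<Sum>j = 1..<n. int j * int (g j)) mod N"
  unfolding sh_def
proof (rule the_equality)
  fix r
  assume "\<exists>h :: nat \<Rightarrow> nat. weight_comb n (\<lambda>j. int (g j)) = weight_comb n (\<lambda>j. int (h j)) \<and>
    r = (\<Sum>j = 1..<n. int j * int (h j)) mod N"
  then obtain h where h: "weight_comb n (\<lambda>j. int (g j)) = weight_comb n (\<lambda>j. int (h j))"
    "r = (\<Sum>j = 1..<n. int j * int (h j)) mod N" by blast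
  have "(\<Sum>j = 1..<n. int j * int (h j)) = (\<Sum>j = 1..<n. int j * int (g j))"
    by (rule sum.cong[OF refl]) (use weight_comb_inj[OF h(1)] in simp)
  then show "r = (\<Sum>j = 1..<n. int j * int (g j)) mod N" using h(2) by simp
qed auto

section \<open>The weight of a double coset and the inverse bijection\<close>

lemma shift_coeff_eq: "coset_elt n p (int i) = k + int i + c * N \<Longrightarrow> shift_coeff n k p i = c"
  unfolding shift_coeff_def by (rule the_equality) (use N_pos in auto)

lemma coset_weight_eq:
  assumes "\<And>i. i \<in> {1..N} \<Longrightarrow> coset_elt n p i = k + i + c i * N"
  shows "coset_weight n (k, p) = weight_comb n (\<lambda>i. c (int i + 1) - c (int i))"
  unfolding coset_weight_def prod.case
proof (rule weight_comb_cong)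
  fix i assume "i \<in> {1..<n}"
  then show "shift_coeff n k p (i + 1) - shift_coeff n k p i = c (int i + 1) - c (int i)"
    using assms[of "int i"] assms[of "int i + 1"] shift_coeff_eq[of p i k "c (int i)"]
      shift_coeff_eq[of p "i + 1" k "c (int i + 1)"] by (simp add: algebra_simps)
qed

lemma sum_coeffs:
  assumes x: "x \<in> carrier W" and form: "\<And>i. i \<in> {1..N} \<Longrightarrow> x i = k + i + c i * N"
  shows "(\<Sum>i = 1..N. c i) = - k"
proof -
  have "(\<Sum>i = 1..N. x i - i) = (\<Sum>i = 1..N. k + c i * N)"
    by (rule sum.cong) (use form in auto)
  also have "\<dots> = N * k + (\<Sum>i = 1..N. c i) * N"
    by (simp add: sum.distrib sum_distrib_right)
  also have "\<dots> = (k + (\<Sum>i = 1..N. c i)) * N" by (simp add: algebra_simps)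
  finally show ?thesis using carrierD(4)[OF x] N_pos by simp
qed

text \<open>Equal weights have equal consecutive differences, so the coefficient sequences differ by
  a constant \<open>d\<close>. Comparing their sums gives \<open>k = k' + d * N\<close>, and the
  range of \<open>k\<close> and \<open>k'\<close> forces \<open>d = 0\<close>.\<close>

lemma inj_on_coset_weight: "inj_on (coset_weight n) (coset_coproduct n)"
proof (rule inj_onI, clarify)
  fix k p k' p'
  assume kp: "(k, p) \<in> coset_coproduct n" "(k', p') \<in> coset_coproduct n"
    and eq: "coset_weight n (k, p) = coset_weight n (k', p')"
  then have k: "0 \<le> k" "k < N" "0 \<le> k'" "k' < N"
    and p: "p \<in> weyl_double_cosets n k" "p' \<in> weyl_double_cosets n k'"
    by (auto simp: coset_coproduct_def)
  obtain c where c: "coset_elt n p \<in> carrier W" "p = dcoset k (coset_elt n p)"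
    "\<And>i. i \<in> {1..N} \<Longrightarrow> coset_elt n p i = k + i + c i * N" using coset_elt_form[OF p(1)] by blast
  obtain c' where c': "coset_elt n p' \<in> carrier W" "p' = dcoset k' (coset_elt n p')"
    "\<And>i. i \<in> {1..N} \<Longrightarrow> coset_elt n p' i = k' + i + c' i * N" using coset_elt_form[OF p(2)] by blast
  define d where "d = c' 1 - c 1"
  have "coset_weight n (k, p) = weight_comb n (\<lambda>i. c (int i + 1) - c (int i))"
    by (rule coset_weight_eq) (rule c(3))
  moreover have "coset_weight n (k', p') = weight_comb n (\<lambda>i. c' (int i + 1) - c' (int i))"
    by (rule coset_weight_eq) (rule c'(3))
  ultimately have "weight_comb n (\<lambda>i. c (int i + 1) - c (int i))
      = weight_comb n (\<lambda>i. c' (int i + 1) - c' (int i))"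
    using eq by simp
  note steps = weight_comb_inj[OF this]
  have "i \<le> N \<longrightarrow> c' i = c i + d" if "1 \<le> i" for i
    using that
  proof (induction i rule: int_ge_induct)
    case (step i)
    then have "nat i \<in> {1..<n}" if "i + 1 \<le> N" using that by auto
    with steps[of "nat i"] step show ?case by auto
  qed (simp add: d_def)
  then have c'_eq: "c' i = c i + d" if "i \<in> {1..N}" for i using that by simp
  have "(\<Sum>i = 1..N. c' i) = (\<Sum>i = 1..N. c i + d)"
    by (rule sum.cong) (use c'_eq in auto)
  then have k_eq: "k = k' + d * N"
    using sum_coeffs[OF c(1,3)] sum_coeffs[OF c'(1,3)] by (simp add: sum.distrib algebra_simps)
  have "d = 0"
    \<comment> \<open>The residues run over \<open>0..N - 1\<close> but the window is
      \<open>{1..N}\<close>, hence the shift by one.\<close>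
    by (rule window_unique[of "k + 1" "k' + 1"]) (use k k_eq in auto)
  then have "k = k'" using k_eq by simp
  moreover have "coset_elt n p = coset_elt n p'"
    by (rule carrier_ext[OF c(1) c'(1)]) (use c(3) c'(3) c'_eq \<open>d = 0\<close> \<open>k = k'\<close> in auto)
  ultimately show "k = k' \<and> p = p'" using c(2) c'(2) by simp
qed

text \<open>Each \<open>g j\<close> is counted once for every \<open>i\<close> with
  \<open>j < i \<le> m\<close>.\<close>

lemma sum_partial_sums:
  fixes g :: "nat \<Rightarrow> int"
  shows "(\<Sum>i = 1..m. \<Sum>j = 1..<i. g j) = (\<Sum>j = 1..<m. (int m - int j) * g j)"
proof (induction m)
  case (Suc m)
  have "(\<Sum>j = 1..<Suc m. (int (Suc m) - int j) * g j)
      = (\<Sum>j = 1..<Suc m. (int m - int j) * g j) + (\<Sum>j = 1..<Suc m. g j)"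
    by (simp add: algebra_simps flip: sum.distrib)
  also have "(\<Sum>j = 1..<Suc m. (int m - int j) * g j) = (\<Sum>j = 1..<m. (int m - int j) * g j)"
    by (cases m) simp_all
  finally show ?case using Suc by simp
qed simp

text \<open>A double coset with weight \<open>lam\<close> is built from explicit coefficients; by
  injectivity it is the value of \<open>psi0\<close>, so its representative can be read off.\<close>

lemma psi0_weight_comb:
  fixes g :: "nat \<Rightarrow> nat"
  defines "lam \<equiv> weight_comb n (\<lambda>j. int (g j))"
  shows "\<exists>p \<in> weyl_double_cosets n (sh n lam).
           psi0 n lam = (sh n lam, p) \<and>
           (\<forall>i \<in> {1..n}. coset_elt n p (int i) =
              int i + (\<Sum>j = 1..<i. int (g j) * N)
                    + (\<Sum>j = 1..<n. int (g j) * (int j - N)))"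
proof -
  define T where "T = (\<Sum>j = 1..<n. int j * int (g j))"
  define G where "G i = (\<Sum>j = 1..<i. int (g j))" for i
  define k where "k = T mod N"
  \<comment> \<open>The increments must be the \<open>g i\<close>. The constant
    \<open>T div N - G n\<close>, which is \<open>c 1\<close> because \<open>G 1 = 0\<close>, is
    forced by the requirement that the \<open>c i\<close> sum to \<open>- k\<close> with
    \<open>k = T mod N\<close>.\<close>
  define c where "c i = T div N - G n + G (nat i)" for i
  have sh: "sh n lam = k" by (simp add: lam_def sh_weight_comb k_def T_def)
  have kT: "k + T div N * N = T" by (simp add: k_def)
  have k_range: "0 \<le> k" "k < N" using N_pos by (simp_all add: k_def)
  have "(\<Sum>i = 1..n. G i) = (\<Sum>j = 1..<n. (N - int j) * int (g j))"
    unfolding G_def by (rule sum_partial_sums)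
  also have "\<dots> = N * G n - T"
    by (simp add: G_def T_def sum_distrib_left left_diff_distrib sum_subtractf)
  finally have "(\<Sum>i = 1..n. G i) = N * G n - T" .
  moreover have "(\<Sum>i = 1..N. c i) = N * (T div N - G n) + (\<Sum>i = 1..n. G i)"
    by (simp add: sum_window_nat c_def sum.distrib)
  ultimately have "(\<Sum>i = 1..N. c i) = - k"
    using kT by (simp add: algebra_simps)
  then obtain w where w: "w \<in> carrier W" "\<And>i. i \<in> {1..N} \<Longrightarrow> w i = k + i + c i * N"
    by (rule carrier_of_coeffs) blast
  have c_step: "c (int i + 1) - c (int i) = int (g i)" if "i \<in> {1..<n}" for i
    using that by (simp add: c_def G_def nat_add_distrib)
  define p where "p = dcoset k w"
  have p: "p \<in> weyl_double_cosets n k" using w(1) by (simp add: p_def weyl_double_cosets_eq)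
  have elt: "coset_elt n p = w"
    unfolding p_def
  proof (rule coset_elt_dcoset[OF w])
    show "c i \<le> c (i + 1)" if "1 \<le> i" "i < N" for i
    proof -
      have "nat i \<in> {1..<n}" using that by auto
      from c_step[OF this] show ?thesis using that by simp
    qed
  qed
  have "coset_weight n (k, p) = weight_comb n (\<lambda>i. c (int i + 1) - c (int i))"
    by (rule coset_weight_eq) (simp only: elt w(2))
  also have "\<dots> = lam" unfolding lam_def by (rule weight_comb_cong) (rule c_step)
  finally have cw: "coset_weight n (k, p) = lam" .
  have "(k, p) \<in> coset_coproduct n" using p k_range by (simp add: coset_coproduct_def)
  then have "psi0 n lam = (k, p)"
    using the_inv_into_f_f[OF inj_on_coset_weight, of "(k, p)"] cw
    by (auto simp: psi0_def dominant_weights_def lam_def)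
  \<comment> \<open>Since \<open>k + T div N * N = T\<close>, the value of \<open>w\<close> at
    \<open>i\<close> is \<open>i + G i * N + (T - G n * N)\<close>; the bracket is the second
    sum.\<close>
  moreover have "coset_elt n p (int i) = int i + (\<Sum>j = 1..<i. int (g j) * N)
      + (\<Sum>j = 1..<n. int (g j) * (int j - N))" if "i \<in> {1..n}" for i
  proof -
    have "(\<Sum>j = 1..<n. int (g j) * (int j - N)) = T - G n * N"
      by (simp add: G_def T_def right_diff_distrib sum_subtractf mult.commute
          flip: sum_distrib_left)
    moreover have "(\<Sum>j = 1..<i. int (g j) * N) = G i * N"
      by (simp add: G_def sum_distrib_right)
    moreover have "w (int i) = k + int i + (T div N - G n + G i) * N"
      using w(2)[of "int i"] that by (simp add: c_def)
    ultimately show ?thesis using kT by (simp add: elt algebra_simps)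
  qed
  ultimately show ?thesis using p sh by blast
qed

end

theorem theorem2p22:
  fixes n :: nat and g :: "nat \<Rightarrow> nat" and lam :: weight
  assumes "n \<ge> 2"
    and "lam = weight_comb n (\<lambda>j. int (g j))"
  shows "\<exists>p \<in> weyl_double_cosets n (sh n lam).
           psi0 n lam = (sh n lam, p) \<and>
           (\<forall>i \<in> {1..n}. coset_elt n p (int i) =
              int i + (\<Sum>j = 1..<i. int (g j) * int n)
                    + (\<Sum>j = 1..<n. int (g j) * (int j - int n)))"
  unfolding assms(2) by (rule affine_perm.psi0_weight_comb) (use assms(1) in unfold_locales)

end
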